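(* Let $\mathcal{L}$ be the set of free states of a quantum resource theory on a finite-dimensional Hilbert space, let $\rho\notin\mathcal{L}$ be a resource state with generalized robustness $\mathcal{R}_{\mathcal{L}}(\rho)$, and let $Y^*$ be an optimal robustness witness for $\rho$. Let $\beta\in(0,\infty)$ be the inverse temperature of a thermal bath. Then for every real $\lambda>0$ with $\lambda\ge \beta^{-1}S(\rho)/\mathcal{R}_{\mathcal{L}}(\rho)$, $$\xi_{\mathrm{out}}(\rho)\;\ge\;1+\frac{\mathcal{R}_{\mathcal{L}}(\rho)-\lambda^{-1}\beta^{-1}S(\rho)}{1+\lambda^{-1}\beta^{-1}S\big(\tau^{\beta}_{\lambda Y^*}\big)},$$ where $\tau^{\beta}_{\lambda Y^*}$ is the thermal state of the Hamiltonian $\lambda Y^*$ at inverse temperature $\beta$. Moreover, at zero temperature, $\xi_{\mathrm{out}}(\rho)\ge 1+\mathcal{R}_{\mathcal{L}}(\rho)$.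
   Context: All Hilbert spaces are finite-dimensional; a state is a positive semidefinite operator of unit trace. $\mathcal{L}$ is a nonempty, closed, convex set of states, called free (resource-less) states; states not in $\mathcal{L}$ are called resource states. Generalized robustness: $\mathcal{R}_{\mathcal{L}}(\rho):=\min\{s\ge 0 : \text{there is a state }\gamma\text{ with }\frac{\rho+s\gamma}{1+s}\in\mathcal{L}\}$. One has $\mathcal{R}_{\mathcal{L}}(\rho)=0$ if and only if $\rho\in\mathcal{L}$. It has the dual form $\mathcal{R}_{\mathcal{L}}(\rho)=\max\{\mathrm{Tr}(Y\rho)-1 : Y\ge 0,\ \mathrm{Tr}(Y\sigma)\le 1\ \forall\sigma\in\mathcal{L}\}$ ($Y$ Hermitian). An optimal robustness witness for $\rho$ is an operator $Y^*\ge0$ with $\mathrm{Tr}(Y^*\sigma)\le 1$ for all $\sigma\in\mathcal{L}$ and $\mathrm{Tr}(Y^*\rho)-1=\mathcal{R}_{\mathcal{L}}(\rho)$. For a Hamiltonian (Hermitian operator) $H$: $S(\rho)=-\mathrm{Tr}(\rho\log\rho)$ is the von Neumann entropy (natural logarithm), $F_H(\rho):=\mathrm{Tr}(H\rho)-\beta^{-1}S(\rho)$ is the free energy, $\tau_H^\beta:=e^{-\beta H}/\mathrm{Tr}(e^{-\beta H})$ is the thermal state, and the extractable work is $W_H^{\mathrm{out}}(\rho):=F_H(\rho)-F_H(\tau_H^\beta)\ge 0$. The work-extraction advantage is $$\xi_{\mathrm{out}}(\rho):=\max_{H\ge 0}\frac{W_H^{\mathrm{out}}(\rho)}{\max_{\sigma\in\mathcal{L}}W_H^{\mathrm{out}}(\sigma)},$$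 the outer maximum (a supremum, possibly $+\infty$, if not attained) being over all positive semidefinite Hamiltonians $H$ on the system; Hamiltonians for which numerator and denominator both vanish are excluded, and a ratio with positive numerator and zero denominator is $+\infty$. Zero temperature means $\beta^{-1}=0$: the entropic terms vanish, so $F_H(\rho)=\mathrm{Tr}(H\rho)$ and $F_H(\tau_H^\beta)$ is replaced by the smallest eigenvalue of $H$, and $\xi_{\mathrm{out}}$ is defined with these quantities. *)

theory Defs
  imports "HOL-Analysis.Analysis"
begin

text \<open>Operators on an \<open>n\<close>-dimensional Hilbert space are complex matrices, in a fixed orthonormal
  basis. On \<open>complex^'n\<close> the library's \<open>v \<bullet> w\<close> is the real part of the Hermitian inner product,
  and its norm is the Hilbert space norm.\<close>

definition hermitian :: "complex^'n^'n \<Rightarrow> bool" where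
  "hermitian A \<longleftrightarrow> (\<forall>i j. A $ i $ j = cnj (A $ j $ i))"

text \<open>For Hermitian \<open>A\<close> the number \<open>\<langle>v, A v\<rangle>\<close> is real, so it equals \<open>v \<bullet> (A *v v)\<close>.\<close>

definition psd :: "complex^'n^'n \<Rightarrow> bool" where
  "psd A \<longleftrightarrow> hermitian A \<and> (\<forall>v. 0 \<le> v \<bullet> (A *v v))"

definition states :: "(complex^'n^'n) set" where
  "states = {\<rho>. psd \<rho> \<and> trace \<rho> = 1}"

text \<open>The trace of a product of two Hermitian matrices is real; \<open>Re\<close> only changes the type.\<close>

definition expval :: "complex^'n^'n \<Rightarrow> complex^'n^'n \<Rightarrow> real" where
  "expval A \<rho> = Re (trace (A ** \<rho>))"

definition real_eigenvalues :: "complex^'n^'n \<Rightarrow> real set" where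
  "real_eigenvalues A = {e. \<exists>v. v \<noteq> 0 \<and> A *v v = e *\<^sub>R v}"

text \<open>Functional calculus \<open>f(A)\<close> of a Hermitian matrix: the operator acting as \<open>f e\<close> on the
  \<open>e\<close>-eigenspace of \<open>A\<close>. By the spectral theorem it exists, and it is unique since the
  eigenvectors span the space.\<close>

definition matrix_fun :: "(real \<Rightarrow> real) \<Rightarrow> complex^'n^'n \<Rightarrow> complex^'n^'n" where
  "matrix_fun f A = (THE B. \<forall>e v. A *v v = e *\<^sub>R v \<longrightarrow> B *v v = f e *\<^sub>R v)"

text \<open>The value of \<open>ln 0\<close> is irrelevant: \<open>\<rho>\<close> vanishes on its own kernel, so \<open>0 log 0 = 0\<close>.\<close>

definition entropy :: "complex^'n^'n \<Rightarrow> real" where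
  "entropy \<rho> = - Re (trace (\<rho> ** matrix_fun ln \<rho>))"

definition thermal_state :: "real \<Rightarrow> complex^'n^'n \<Rightarrow> complex^'n^'n" where
  "thermal_state \<beta> H =
     (let E = matrix_fun exp (- \<beta> *\<^sub>R H) in (1 / Re (trace E)) *\<^sub>R E)"

definition free_energy :: "real \<Rightarrow> complex^'n^'n \<Rightarrow> complex^'n^'n \<Rightarrow> real" where
  "free_energy \<beta> H \<rho> = expval H \<rho> - entropy \<rho> / \<beta>"

definition work_out :: "real \<Rightarrow> complex^'n^'n \<Rightarrow> complex^'n^'n \<Rightarrow> real" where
  "work_out \<beta> H \<rho> = free_energy \<beta> H \<rho> - free_energy \<beta> H (thermal_state \<beta> H)"

definition work_out_zero_temp :: "complex^'n^'n \<Rightarrow> complex^'n^'n \<Rightarrow> real" where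
  "work_out_zero_temp H \<rho> = expval H \<rho> - Min (real_eigenvalues H)"

text \<open>The infimum is taken in the extended reals: it is \<open>\<infinity>\<close> when no admissible \<open>s\<close> exists, and
  otherwise a minimum, by compactness.\<close>

definition robustness :: "(complex^'n^'n) set \<Rightarrow> complex^'n^'n \<Rightarrow> ereal" where
  "robustness L \<rho> =
     (INF s\<in>{s. 0 \<le> s \<and> (\<exists>\<gamma>\<in>states. (1 / (1 + s)) *\<^sub>R (\<rho> + s *\<^sub>R \<gamma>) \<in> L)}. ereal s)"

definition optimal_witness ::
  "(complex^'n^'n) set \<Rightarrow> complex^'n^'n \<Rightarrow> complex^'n^'n \<Rightarrow> bool" where
  "optimal_witness L \<rho> Y \<longleftrightarrow>
     psd Y \<and> (\<forall>\<sigma>\<in>L. expval Y \<sigma> \<le> 1) \<and> ereal (expval Y \<rho> - 1) = robustness L \<rho>"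

text \<open>Division is that of \<^typ>\<open>ereal\<close>, where \<open>a / 0 = \<infinity>\<close> for \<open>a > 0\<close>. The argument \<open>W H \<rho>\<close> is
  the work extractable from \<open>\<rho>\<close> under the Hamiltonian \<open>H\<close>.\<close>

definition work_advantage ::
  "(complex^'n^'n \<Rightarrow> complex^'n^'n \<Rightarrow> real) \<Rightarrow> (complex^'n^'n) set \<Rightarrow> complex^'n^'n \<Rightarrow> ereal" where
  "work_advantage W L \<rho> =
     (SUP H\<in>{H. psd H \<and> \<not> (W H \<rho> = 0 \<and> (SUP \<sigma>\<in>L. ereal (W H \<sigma>)) = 0)}.
        ereal (W H \<rho>) / (SUP \<sigma>\<in>L. ereal (W H \<sigma>)))"

definition xi_out :: "real \<Rightarrow> (complex^'n^'n) set \<Rightarrow> complex^'n^'n \<Rightarrow> ereal" where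
  "xi_out \<beta> = work_advantage (work_out \<beta>)"

definition xi_out_zero_temp :: "(complex^'n^'n) set \<Rightarrow> complex^'n^'n \<Rightarrow> ereal" where
  "xi_out_zero_temp = work_advantage work_out_zero_temp"

end

theory Submission
  imports Defs
begin

text \<open>
  The Hamiltonian \<open>H = t Y\<close> attains the bound. Write \<open>x = - F(\<tau>)\<close> for the thermal state \<open>\<tau>\<close> of \<open>H\<close>. On
  free states \<open>tr (Y \<sigma>) \<le> 1\<close> and \<open>S(\<sigma>) \<ge> 0\<close>, so the extractable work is at most \<open>t + x\<close>, whereas that of
  \<open>\<rho>\<close> is \<open>t (1 + R) - S(\<rho>) / \<beta> + x\<close>; finally \<open>x \<le> S(\<tau>) / \<beta>\<close> because \<open>H \<ge> 0\<close>. If no work can be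
  extracted from any free state, then \<open>\<tau>\<close> is the only one by Gibbs' variational principle, hence
  \<open>\<rho>\<close> yields positive work and the ratio is infinite. At zero temperature the same argument
  applies to \<open>H = Y\<close>, whose smallest eigenvalue lies in \<open>[0, 1]\<close>.

  Complex matrices are treated as symmetric operators of the real Euclidean space underlying
  \<open>complex^'n\<close>. Hence eigenbases are real orthonormal bases with \<open>2n\<close> elements, in which every
  eigenvalue is repeated, and real traces are twice the complex ones.
\<close>

section \<open>Orthonormal bases and the spectral theorem\<close>

definition orthonormal_basis :: "'a::euclidean_space set \<Rightarrow> bool" where
  "orthonormal_basis B \<longleftrightarrow>
     finite B \<and> (\<forall>b\<in>B. \<forall>c\<in>B. b \<bullet> c = (if b = c then 1 else 0)) \<and> span B = UNIV"

lemma orthonormal_basis_Basis: "orthonormal_basis Basis"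
  by (auto simp: orthonormal_basis_def inner_Basis)

context
  fixes B :: "'a::euclidean_space set"
  assumes B: "orthonormal_basis B"
begin

lemma onb_finite: "finite B"
  using B by (simp add: orthonormal_basis_def)

lemma onb_inner: "b \<in> B \<Longrightarrow> c \<in> B \<Longrightarrow> b \<bullet> c = (if b = c then 1 else 0)"
  using B by (simp add: orthonormal_basis_def)

lemma onb_norm: "b \<in> B \<Longrightarrow> norm b = 1"
  using onb_inner[of b b] by (simp add: norm_eq_1)

lemma onb_expand: "(\<Sum>b\<in>B. (x \<bullet> b) *\<^sub>R b) = x"
proof (rule orthonormal_basis_expand)
  show "pairwise orthogonal B"
    using onb_inner by (auto simp: pairwise_def orthogonal_def)
  show "x \<in> span B"
    using B by (simp add: orthonormal_basis_def)
qed (use onb_norm onb_finite in auto)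

lemma onb_linear_expand:
  assumes "linear f"
  shows "f x = (\<Sum>b\<in>B. (x \<bullet> b) *\<^sub>R f b)"
  by (subst onb_expand[symmetric]) (simp add: linear_sum[OF assms] linear_cmul[OF assms])

lemma onb_inner_expand: "x \<bullet> y = (\<Sum>b\<in>B. (x \<bullet> b) * (y \<bullet> b))"
proof -
  have "x \<bullet> y = x \<bullet> (\<Sum>b\<in>B. (y \<bullet> b) *\<^sub>R b)"
    by (simp add: onb_expand)
  then show ?thesis
    by (simp add: inner_sum_right mult.commute)
qed

lemma onb_sum_inner:
  assumes "c \<in> B"
  shows "(\<Sum>b\<in>B. g b *\<^sub>R b) \<bullet> c = g c"
proof -
  have "(\<Sum>b\<in>B. g b *\<^sub>R b) \<bullet> c = (\<Sum>b\<in>B. if b = c then g b else 0)"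
    using onb_inner assms by (auto simp: inner_sum_left intro!: sum.cong)
  also have "\<dots> = g c"
    using onb_finite assms by simp
  finally show ?thesis .
qed

lemma onb_nonempty: "B \<noteq> {}"
proof
  assume "B = {}"
  then have "x = 0" for x :: 'a
    using onb_expand[of x] by simp
  then show False
    using nonempty_Basis nonzero_Basis by blast
qed

end

text \<open>Expanding each \<open>f b\<close> in \<open>D\<close> and swapping the sums leaves, for
  each \<open>d\<close>, the expansion of \<open>f d\<close> in \<open>B\<close>. This lets traces
  be computed in any convenient eigenbasis.\<close>

lemma onb_trace:
  fixes f :: "'a::euclidean_space \<Rightarrow> 'a"
  assumes B: "orthonormal_basis B" and D: "orthonormal_basis D" and f: "linear f"
  shows "(\<Sum>b\<in>B. b \<bullet> f b) = (\<Sum>d\<in>D. d \<bullet> f d)"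
proof -
  have "(\<Sum>b\<in>B. b \<bullet> f b) = (\<Sum>b\<in>B. \<Sum>d\<in>D. (b \<bullet> d) * (f b \<bullet> d))"
    by (subst onb_inner_expand[OF D]) simp
  also have "\<dots> = (\<Sum>d\<in>D. (\<Sum>b\<in>B. (d \<bullet> b) *\<^sub>R f b) \<bullet> d)"
    by (subst sum.swap) (auto simp: inner_sum_left inner_sum_right inner_commute intro!: sum.cong)
  also have "\<dots> = (\<Sum>d\<in>D. d \<bullet> f d)"
    by (simp add: onb_linear_expand[OF B f, symmetric] inner_commute)
  finally show ?thesis .
qed

text \<open>The maximizer of the quadratic form on the unit sphere of an invariant subspace is an
  eigenvector, by the first-order condition.\<close>

lemma symmetric_eigenvector_in_subspace:
  fixes f :: "'a::euclidean_space \<Rightarrow> 'a"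
  assumes f: "linear f" and sym: "\<And>v w. f v \<bullet> w = v \<bullet> f w"
    and S: "subspace S" "f ` S \<subseteq> S" "S \<noteq> {0}"
  obtains v e where "v \<in> S" "norm v = 1" "f v = e *\<^sub>R v"
proof -
  obtain x where x: "x \<in> S" "x \<noteq> 0"
    using S subspace_0 by fastforce
  have "(1 / norm x) *\<^sub>R x \<in> S \<inter> sphere 0 1"
    using x S(1) by (simp add: subspace_scale)
  then have ne: "S \<inter> sphere 0 1 \<noteq> {}" by blast
  have comp: "compact (S \<inter> sphere 0 1)"
    using S(1) by (simp add: closed_subspace closed_Int_compact)
  have "continuous_on (S \<inter> sphere 0 1) (\<lambda>v. v \<bullet> f v)"
    using f by (intro continuous_intros linear_continuous_on) (simp add: linear_conv_bounded_linear)
  from continuous_attains_sup[OF comp ne this]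
  obtain v where v: "v \<in> S" "norm v = 1"
    and vmax: "\<And>w. w \<in> S \<Longrightarrow> norm w = 1 \<Longrightarrow> w \<bullet> f w \<le> v \<bullet> f v"
    by auto
  define e where "e = v \<bullet> f v"
  \<comment> \<open>Homogeneity carries the maximum from the unit sphere to all of
    \<open>S\<close>.\<close>
  have ray: "w \<bullet> f w \<le> e * (w \<bullet> w)" if "w \<in> S" for w
  proof (cases "w = 0")
    case False
    have "((1 / norm w) *\<^sub>R w) \<bullet> f ((1 / norm w) *\<^sub>R w) \<le> e"
      unfolding e_def using False that S(1) by (intro vmax) (auto simp: subspace_scale)
    then have "(w \<bullet> f w) / (norm w)\<^sup>2 \<le> e"
      by (simp add: linear_cmul[OF f] power2_eq_square)
    then show ?thesis
      using False by (simp add: field_simps power2_norm_eq_inner)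
  qed (simp add: linear_0[OF f])
  \<comment> \<open>Moving from \<open>v\<close> to \<open>v + s *\<^sub>R w\<close> gives a
    quadratic in \<open>s\<close> that is nonnegative everywhere and has no constant term, so its
    linear coefficient \<open>2 * c\<close> must vanish.\<close>
  have first_order: "e * (v \<bullet> w) = f v \<bullet> w" if w: "w \<in> S" for w
  proof -
    define a where "a = e * (w \<bullet> w) - w \<bullet> f w"
    define c where "c = e * (v \<bullet> w) - f v \<bullet> w"
    have vf: "v \<bullet> f w = f v \<bullet> w" "w \<bullet> f v = f v \<bullet> w"
      by (simp only: sym) (rule inner_commute)
    have q: "0 \<le> 2 * s * c + s\<^sup>2 * a" for s
    proof -
      have "v + s *\<^sub>R w \<in> S"
        using v w S(1) by (simp add: subspace_add subspace_scale)
      from ray[OF this]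
      have "(v + s *\<^sub>R w) \<bullet> f (v + s *\<^sub>R w) \<le> e * ((v + s *\<^sub>R w) \<bullet> (v + s *\<^sub>R w))" .
      moreover have "(v + s *\<^sub>R w) \<bullet> f (v + s *\<^sub>R w) = e + 2 * s * (f v \<bullet> w) + s * s * (w \<bullet> f w)"
        by (simp add: linear_add[OF f] linear_cmul[OF f] inner_add_left inner_add_right vf
            distrib_left flip: e_def)
      moreover have "(v + s *\<^sub>R w) \<bullet> (v + s *\<^sub>R w) = 1 + 2 * s * (v \<bullet> w) + s * s * (w \<bullet> w)"
        using v(2) by (simp add: inner_add_left inner_add_right norm_eq_1 inner_commute[of w v] distrib_left)
      ultimately have "0 \<le> e * (1 + 2 * s * (v \<bullet> w) + s * s * (w \<bullet> w))
          - (e + 2 * s * (f v \<bullet> w) + s * s * (w \<bullet> f w))"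
        by simp
      also have "\<dots> = 2 * s * c + s\<^sup>2 * a"
        unfolding a_def c_def power2_eq_square by algebra
      finally show ?thesis .
    qed
    have a: "0 \<le> a"
      using ray[OF w] by (simp add: a_def)
    have "c = 0"
    proof (rule ccontr)
      assume "c \<noteq> 0"
      \<comment> \<open>The minimizer would be \<open>- c / a\<close>; the shift to
        \<open>a + 1\<close> keeps the denominator positive when \<open>a = 0\<close>, and the
        quadratic is still negative there.\<close>
      define s where "s = - c / (a + 1)"
      have c: "c = - s * (a + 1)"
        using a by (simp add: s_def)
      have "2 * s * c + s\<^sup>2 * a = - (s\<^sup>2 * (a + 2))"
        unfolding c by (simp add: power2_eq_square algebra_simps)
      moreover have "s\<^sup>2 * (a + 2) > 0"
        using a \<open>c \<noteq> 0\<close> by (simp add: s_def)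
      ultimately show False
        using q[of s] by linarith
    qed
    then show ?thesis by (simp add: c_def)
  qed
  \<comment> \<open>The residual \<open>e *\<^sub>R v - f v\<close> lies in \<open>S\<close> by
    invariance and is orthogonal to \<open>S\<close> by the first-order condition, hence to
    itself.\<close>
  have mem: "e *\<^sub>R v - f v \<in> S"
    using v S by (auto simp: subspace_diff subspace_scale)
  have "(e *\<^sub>R v - f v) \<bullet> (e *\<^sub>R v - f v) = 0"
    using first_order[OF mem] by (simp add: inner_diff_left)
  then have "f v = e *\<^sub>R v" by simp
  with v show thesis by (rule that)
qed

text \<open>Induction on the dimension of an invariant subspace: split off a unit eigenvector
  \<open>v\<close>. By symmetry, its orthogonal complement inside the subspace is again invariant,
  and it has smaller dimension.\<close>

theorem symmetric_spectral_theorem: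
  fixes f :: "'a::euclidean_space \<Rightarrow> 'a"
  assumes f: "linear f" and sym: "\<And>v w. f v \<bullet> w = v \<bullet> f w"
  obtains B e where "orthonormal_basis B" "\<And>b. b \<in> B \<Longrightarrow> f b = e b *\<^sub>R b"
proof -
  have "\<exists>B. finite B \<and> B \<subseteq> S \<and> (\<forall>b\<in>B. \<forall>c\<in>B. b \<bullet> c = (if b = c then 1 else 0)) \<and>
      S \<subseteq> span B \<and> (\<forall>b\<in>B. \<exists>e. f b = e *\<^sub>R b)"
    if "subspace S" "f ` S \<subseteq> S" for S
    using that
  proof (induction "dim S" arbitrary: S rule: less_induct)
    case less
    show ?case
    proof (cases "S = {0}")
      case True
      then show ?thesis by (intro exI[of _ "{}"]) auto
    next
      case False
      obtain v e where v: "v \<in> S" "norm v = 1" "f v = e *\<^sub>R v"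
        by (rule symmetric_eigenvector_in_subspace[OF f sym less.prems False])
      have vv: "v \<bullet> v = 1" using v(2) by (simp add: norm_eq_1)
      define T where "T = S \<inter> {w. v \<bullet> w = 0}"
      have T: "subspace T"
        unfolding T_def using less.prems(1) by (simp add: subspace_inter subspace_hyperplane)
      have fT: "f ` T \<subseteq> T"
        using less.prems(2) by (auto simp: T_def sym[of v, symmetric] v(3))
      have dimT: "dim T < dim S"
      proof (rule dim_psubset)
        have "v \<notin> T" using vv by (simp add: T_def)
        then have "T \<subset> S" using v(1) T_def by blast
        then show "span T \<subset> span S"
          using T less.prems(1) by (simp only: span_eq_iff[THEN iffD2])
      qed
      from less.hyps[OF dimT T fT] obtain C where C: "finite C" "C \<subseteq> T"
        "\<forall>b\<in>C. \<forall>c\<in>C. b \<bullet> c = (if b = c then 1 else 0)"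
        "T \<subseteq> span C" "\<forall>b\<in>C. \<exists>e. f b = e *\<^sub>R b"
        by (elim exE conjE) (rule that)
      have Cv: "v \<bullet> c = 0" "c \<bullet> v = 0" "c \<noteq> v" if "c \<in> C" for c
        using that C(2) vv unfolding T_def by (auto simp: inner_commute[of c v])
      have "S \<subseteq> span (insert v C)"
      proof (rule subsetI)
        fix w assume "w \<in> S"
        then have "w - (v \<bullet> w) *\<^sub>R v \<in> T"
          using v(1) vv less.prems(1) by (simp add: T_def subspace_diff subspace_scale inner_diff_right)
        then have "w - (v \<bullet> w) *\<^sub>R v \<in> span C" using C(4) by blast
        then show "w \<in> span (insert v C)"
          unfolding span_insert by blast
      qed
      moreover have "insert v C \<subseteq> S"
        using C(2) v(1) T_def by blast
      moreover have "\<forall>b\<in>insert v C. \<forall>c\<in>insert v C. b \<bullet> c = (if b = c then 1 else 0)"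
        using C(3) Cv vv by (metis insert_iff)
      moreover have "\<forall>b\<in>insert v C. \<exists>e. f b = e *\<^sub>R b"
        using C(5) v(3) by blast
      ultimately show ?thesis
        using C(1) by blast
    qed
  qed
  from this[OF subspace_UNIV subset_UNIV] obtain B where
    B: "finite B" "\<forall>b\<in>B. \<forall>c\<in>B. b \<bullet> c = (if b = c then 1 else 0)" "UNIV \<subseteq> span B"
    and eig: "\<forall>b\<in>B. \<exists>e. f b = e *\<^sub>R b"
    by (elim exE conjE) (rule that)
  have "orthonormal_basis B"
    unfolding orthonormal_basis_def using B(1,2) top.extremum_uniqueI[OF B(3)] by (intro conjI)
  moreover from bchoice[OF eig] obtain e where "\<forall>b\<in>B. f b = e b *\<^sub>R b"
    by (rule exE)
  ultimately show thesis
    by (intro that[of B e]) (assumption, erule bspec)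
qed

section \<open>Spectral calculus of Hermitian matrices\<close>

definition eigenbasis :: "complex^'n^'n \<Rightarrow> (complex^'n) set \<Rightarrow> (complex^'n \<Rightarrow> real) \<Rightarrow> bool" where
  "eigenbasis A B e \<longleftrightarrow> orthonormal_basis B \<and> (\<forall>b\<in>B. A *v b = e b *\<^sub>R b)"

lemma eigenbasis_onb: "eigenbasis A B e \<Longrightarrow> orthonormal_basis B"
  by (simp add: eigenbasis_def)

lemma eigenbasis_mult: "eigenbasis A B e \<Longrightarrow> b \<in> B \<Longrightarrow> A *v b = e b *\<^sub>R b"
  by (simp add: eigenbasis_def)

lemma inner_complex_vec: "v \<bullet> w = Re (\<Sum>i\<in>UNIV. v $ i * cnj (w $ i))" for v w :: "complex^'n"
  by (simp add: inner_vec_def inner_complex_def)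

text \<open>The bridge to real operator theory: \<open>\<bullet>\<close> is the real part of the
  Hermitian inner product, so Hermitian matrices become symmetric real-linear maps.\<close>

lemma hermitian_inner:
  assumes "hermitian A"
  shows "(A *v v) \<bullet> w = v \<bullet> (A *v w)"
proof -
  have h: "cnj (A $ i $ j) = A $ j $ i" for i j
    using assms by (metis hermitian_def)
  have "(\<Sum>i\<in>UNIV. (A *v v) $ i * cnj (w $ i)) = (\<Sum>i\<in>UNIV. \<Sum>j\<in>UNIV. A $ i $ j * v $ j * cnj (w $ i))"
    by (simp add: matrix_vector_mult_def sum_distrib_right)
  also have "\<dots> = (\<Sum>j\<in>UNIV. v $ j * cnj ((A *v w) $ j))"
    by (subst sum.swap) (simp add: matrix_vector_mult_def sum_distrib_left h mult_ac)
  finally show ?thesis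
    by (simp only: inner_complex_vec)
qed

lemma hermitian_eigenbasis:
  assumes "hermitian A"
  obtains B e where "eigenbasis A B e"
proof -
  obtain B e where "orthonormal_basis B" "\<And>b. b \<in> B \<Longrightarrow> A *v b = e b *\<^sub>R b"
    using symmetric_spectral_theorem[of "(*v) A"] hermitian_inner[OF assms] by auto
  then show thesis
    using that by (auto simp: eigenbasis_def)
qed

lemma scaleR_matrix_mult: "(c *\<^sub>R A) *v v = c *\<^sub>R (A *v v)" for A :: "complex^'n^'m"
  by (simp add: vec_eq_iff matrix_vector_mult_def scaleR_sum_right)

lemma matrix_mult_scaleR: "A *v (c *\<^sub>R v) = c *\<^sub>R (A *v v)" for A :: "complex^'n^'m"
  by (simp add: linear_cmul)

text \<open>The real standard basis contains both \<open>axis i 1\<close> and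
  \<open>axis i \<i>\<close>, and each contributes \<open>Re (A $ i $ i)\<close>; this is the source
  of the factor 1/2. Basis independence then transfers the formula to \<open>B\<close>.\<close>

lemma Re_trace_onb:
  fixes A :: "complex^'n^'n"
  assumes "orthonormal_basis B"
  shows "Re (trace A) = (\<Sum>b\<in>B. b \<bullet> (A *v b)) / 2"
proof -
  have Basis: "(Basis :: (complex^'n) set) = (\<lambda>(i, u). axis i u) ` (UNIV \<times> Basis)"
    by (auto simp: Basis_vec_def)
  have inj: "inj_on (\<lambda>(i, u). axis i u :: complex^'n) (UNIV \<times> Basis)"
    by (auto simp: inj_on_def axis_eq_axis)
  have diag: "axis i u \<bullet> (A *v axis i u) = Re (A $ i $ i)" if "u \<in> Basis" for i and u :: complex
  proof -
    have "(A *v axis i u) $ i = A $ i $ i * u"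
      by (simp add: matrix_vector_mult_def axis_def if_distrib cong: if_cong)
    then have "axis i u \<bullet> (A *v axis i u) = u \<bullet> (A $ i $ i * u)"
      by (simp add: inner_axis')
    then show ?thesis
      using that by (auto simp: Basis_complex_def inner_complex_def)
  qed
  have "(\<Sum>b\<in>B. b \<bullet> (A *v b)) = (\<Sum>d\<in>Basis. d \<bullet> (A *v d))"
    by (rule onb_trace[OF assms orthonormal_basis_Basis]) simp
  also have "\<dots> = (\<Sum>(i, u)\<in>UNIV \<times> Basis. axis i u \<bullet> (A *v axis i u))"
    unfolding Basis sum.reindex[OF inj] by (simp add: case_prod_unfold)
  also have "\<dots> = (\<Sum>i\<in>UNIV. \<Sum>u\<in>(Basis :: complex set). axis i u \<bullet> (A *v axis i u))"
    by (simp add: sum.cartesian_product)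
  also have "\<dots> = 2 * Re (trace A)"
    by (simp add: diag trace_def sum_distrib_left)
  finally show ?thesis by simp
qed

section \<open>The complex structure and existence of the functional calculus\<close>

lemma imaginary_unit_commute: "A *v (\<i> *s v) = \<i> *s (A *v v)" for A :: "complex^'n^'m"
  by (simp add: vec_eq_iff matrix_vector_mult_def sum_distrib_left mult_ac)

lemma imaginary_unit_scaleR: "\<i> *s (c *\<^sub>R v) = c *\<^sub>R (\<i> *s v)" for v :: "complex^'n"
  by (simp add: vec_eq_iff)

lemma inner_imaginary_unit: "v \<bullet> (\<i> *s v) = 0" "(\<i> *s v) \<bullet> (\<i> *s v) = v \<bullet> v" for v :: "complex^'n"
  by (simp_all add: inner_vec_def inner_complex_def algebra_simps)

text \<open>Commuting with \<open>\<i>\<close> upgrades real linearity to complex linearity, so the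
  images of the unit vectors form the columns of a representing complex matrix.\<close>

lemma complex_linear_matrix:
  fixes g :: "complex^'n \<Rightarrow> complex^'n"
  assumes g: "linear g" and gi: "\<And>v. g (\<i> *s v) = \<i> *s g v"
  obtains M where "\<And>v. M *v v = g v"
proof -
  have gc: "g (c *s v) = c *s g v" for c v
  proof -
    have c: "c *s w = Re c *\<^sub>R w + Im c *\<^sub>R (\<i> *s w)" for w :: "complex^'n"
      by (simp add: vec_eq_iff complex_eq_iff)
    show ?thesis
      unfolding c by (simp add: linear_add[OF g] linear_cmul[OF g] gi)
  qed
  define M where "M = (\<chi> i j. g (axis j 1) $ i)"
  have "M *v v = g v" for v
  proof -
    have "g v = g (\<Sum>j\<in>UNIV. v $ j *s axis j 1)"
      by (simp add: basis_expansion)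
    also have "\<dots> = (\<Sum>j\<in>UNIV. v $ j *s g (axis j 1))"
      by (simp add: linear_sum[OF g] gc)
    finally show ?thesis
      by (simp add: vec_eq_iff M_def matrix_vector_mult_def mult.commute)
  qed
  then show thesis by (rule that)
qed

text \<open>The definite description in \<open>matrix_fun\<close> requires existence and uniqueness.
  The map \<open>g\<close> scales the coordinates in \<open>B\<close> by \<open>f (e b)\<close>; it
  comes from a complex matrix because it commutes with \<open>\<i>\<close>. Uniqueness holds because
  \<open>B\<close> spans.\<close>

lemma matrix_fun_eigenvector:
  fixes A :: "complex^'n^'n"
  assumes eb: "eigenbasis A B e" and v: "A *v v = c *\<^sub>R v"
  shows "matrix_fun f A *v v = f c *\<^sub>R v"
proof -
  note B = eigenbasis_onb[OF eb]
  define g where "g = (\<lambda>v. \<Sum>b\<in>B. (f (e b) * (v \<bullet> b)) *\<^sub>R b)"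
  have lin: "linear g"
    by (rule linearI)
      (simp_all add: g_def inner_add_left algebra_simps sum.distrib scaleR_sum_right)
  have geig: "g v = f c *\<^sub>R v" if v: "A *v v = c *\<^sub>R v" for v c
  proof -
    \<comment> \<open>Coordinates of \<open>v\<close> can be nonzero only where
      \<open>e b = c\<close>, so \<open>f (e b)\<close> may be replaced by \<open>f c\<close>
      throughout.\<close>
    have "c * (v \<bullet> b) = e b * (v \<bullet> b)" if b: "b \<in> B" for b
    proof -
      have "A *v v = (\<Sum>b\<in>B. ((v \<bullet> b) * e b) *\<^sub>R b)"
        by (subst onb_linear_expand[OF B]) (simp_all add: eigenbasis_mult[OF eb])
      then have "(A *v v) \<bullet> b = (v \<bullet> b) * e b"
        by (simp add: onb_sum_inner[OF B b])
      then show ?thesis by (simp add: v)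
    qed
    then have "f (e b) * (v \<bullet> b) = f c * (v \<bullet> b)" if "b \<in> B" for b
      using that by (cases "v \<bullet> b = 0") auto
    then have "g v = (\<Sum>b\<in>B. f c *\<^sub>R ((v \<bullet> b) *\<^sub>R b))"
      unfolding g_def by (intro sum.cong) (simp_all only: scaleR_scaleR)
    then show ?thesis
      by (simp add: scaleR_sum_right[symmetric] onb_expand[OF B] del: scaleR_scaleR)
  qed
  have "g (\<i> *s v) = \<i> *s g v" for v
  proof -
    \<comment> \<open>The vector \<open>\<i> *s b\<close> need not belong to \<open>B\<close>, but
      it is an eigenvector of \<open>A\<close> for the same eigenvalue, which is all that
      \<open>geig\<close> asks for.\<close>
    have gib: "g (\<i> *s b) = f (e b) *\<^sub>R (\<i> *s b)" if "b \<in> B" for b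
      by (rule geig) (simp add: imaginary_unit_commute eigenbasis_mult[OF eb that] imaginary_unit_scaleR)
    have lin': "linear (\<lambda>v. g (\<i> *s v))"
      by (rule linearI)
        (simp_all add: vector_add_ldistrib imaginary_unit_scaleR linear_add[OF lin] linear_cmul[OF lin])
    have "g (\<i> *s v) = (\<Sum>b\<in>B. (v \<bullet> b) *\<^sub>R (f (e b) *\<^sub>R (\<i> *s b)))"
      by (subst onb_linear_expand[OF B lin']) (simp add: gib)
    also have "\<dots> = \<i> *s g v"
      by (simp add: g_def vec_eq_iff sum_distrib_left scaleR_conv_of_real mult_ac)
    finally show ?thesis .
  qed
  then obtain M where M: "\<And>v. M *v v = g v"
    using complex_linear_matrix[OF lin] by blast
  have "matrix_fun f A = M"
    unfolding matrix_fun_def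
  proof (rule the_equality)
    show "\<forall>e v. A *v v = e *\<^sub>R v \<longrightarrow> M *v v = f e *\<^sub>R v"
      by (simp add: M geig)
    fix N assume N: "\<forall>e v. A *v v = e *\<^sub>R v \<longrightarrow> N *v v = f e *\<^sub>R v"
    have "N *v v = M *v v" for v
      unfolding onb_linear_expand[OF B matrix_vector_mul_linear[of N], of v]
        onb_linear_expand[OF B matrix_vector_mul_linear[of M], of v]
      using N[rule_format, OF eigenbasis_mult[OF eb]] geig[OF eigenbasis_mult[OF eb]]
      by (intro sum.cong) (simp_all add: M)
    then show "N = M" by (simp add: matrix_eq)
  qed
  then show ?thesis by (simp add: M geig v)
qed

lemma eigenbasis_matrix_fun:
  "eigenbasis A B e \<Longrightarrow> eigenbasis (matrix_fun f A) B (\<lambda>b. f (e b))"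
  using matrix_fun_eigenvector by (fastforce simp: eigenbasis_def)

lemma eigenbasis_scaleR: "eigenbasis A B e \<Longrightarrow> eigenbasis (c *\<^sub>R A) B (\<lambda>b. c * e b)"
  by (simp add: eigenbasis_def scaleR_matrix_mult)

section \<open>Traces, expectation values and entropy in eigenbases\<close>

lemma Re_trace_eigenbasis:
  assumes "eigenbasis A B e"
  shows "Re (trace A) = (\<Sum>b\<in>B. e b) / 2"
proof -
  have "b \<bullet> (A *v b) = e b" if "b \<in> B" for b
    using onb_inner[OF eigenbasis_onb[OF assms] that that] by (simp add: eigenbasis_mult[OF assms that])
  then show ?thesis
    by (simp add: Re_trace_onb[OF eigenbasis_onb[OF assms]])
qed

lemma eigenbasis_quadratic_form:
  assumes "eigenbasis A B e"
  shows "v \<bullet> (A *v v) = (\<Sum>b\<in>B. e b * (v \<bullet> b)\<^sup>2)"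
  by (subst onb_linear_expand[OF eigenbasis_onb[OF assms], where f = "(*v) A"])
    (auto simp: eigenbasis_mult[OF assms] inner_sum_right power2_eq_square intro!: sum.cong)

lemma expval_eigenbasis:
  assumes "eigenbasis \<sigma> B p"
  shows "expval A \<sigma> = (\<Sum>b\<in>B. p b * (b \<bullet> (A *v b))) / 2"
  unfolding expval_def Re_trace_onb[OF eigenbasis_onb[OF assms]]
  by (simp add: matrix_vector_mul_assoc[symmetric] eigenbasis_mult[OF assms] matrix_mult_scaleR)

lemma entropy_eigenbasis:
  assumes "eigenbasis \<sigma> B p"
  shows "entropy \<sigma> = - (\<Sum>b\<in>B. p b * ln (p b)) / 2"
proof -
  have "eigenbasis (\<sigma> ** matrix_fun ln \<sigma>) B (\<lambda>b. p b * ln (p b))"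
    using eigenbasis_matrix_fun[OF assms, of ln] assms
    by (simp add: eigenbasis_def matrix_vector_mul_assoc[symmetric] matrix_mult_scaleR)
  then show ?thesis
    by (simp add: entropy_def Re_trace_eigenbasis)
qed

lemma expval_scaleR: "expval (c *\<^sub>R A) \<sigma> = c * expval A \<sigma>"
  by (simp add: expval_def trace_def matrix_matrix_mult_def sum_distrib_left mult_ac)

text \<open>Shows that the spectrum is finite and nonempty, which gives meaning to the
  \<open>Min\<close> in the zero-temperature work.\<close>

lemma real_eigenvalues_eigenbasis:
  assumes "eigenbasis A B e"
  shows "real_eigenvalues A = e ` B"
proof
  show "e ` B \<subseteq> real_eigenvalues A"
    using eigenbasis_mult[OF assms] onb_norm[OF eigenbasis_onb[OF assms]] norm_zero
    unfolding real_eigenvalues_def by (smt (verit) image_subset_iff mem_Collect_eq)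
  show "real_eigenvalues A \<subseteq> e ` B"
  proof
    fix c assume "c \<in> real_eigenvalues A"
    then obtain v where v: "v \<noteq> 0" "A *v v = c *\<^sub>R v"
      by (auto simp: real_eigenvalues_def)
    show "c \<in> e ` B"
    proof (rule ccontr)
      assume "c \<notin> e ` B"
      text \<open>The indicator function of \<open>c\<close> vanishes on the spectrum, hence annihilates everything.\<close>
      then have "matrix_fun (\<lambda>x. if x = c then 1 else 0) A *v v = 0"
        using eigenbasis_mult[OF eigenbasis_matrix_fun[OF assms]]
        by (subst onb_linear_expand[OF eigenbasis_onb[OF assms]]) (auto intro!: sum.neutral)
      with matrix_fun_eigenvector[OF assms v(2), of "\<lambda>x. if x = c then 1 else 0"] v(1)
      show False by simp
    qed
  qed
qed

lemma psd_scaleR: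
  assumes "psd A" "0 \<le> c"
  shows "psd (c *\<^sub>R A)"
  unfolding psd_def
proof (intro conjI allI)
  have "A $ i $ j = cnj (A $ j $ i)" for i j
    using assms(1) by (metis psd_def hermitian_def)
  then show "hermitian (c *\<^sub>R A)"
    unfolding hermitian_def by (metis vector_scaleR_component complex_cnj_scaleR)
  show "0 \<le> v \<bullet> ((c *\<^sub>R A) *v v)" for v
    using assms by (simp add: scaleR_matrix_mult psd_def)
qed

section \<open>States, entropy and thermal states\<close>

lemma eigenbasis_diagonal:
  assumes "eigenbasis A B e" "b \<in> B"
  shows "b \<bullet> (A *v b) = e b"
  using onb_inner[OF eigenbasis_onb[OF assms(1)] assms(2,2)] by (simp add: eigenbasis_mult[OF assms])

lemma psd_eigenvalue_nonneg:
  assumes "psd A" "eigenbasis A B e" "b \<in> B"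
  shows "0 \<le> e b"
  using assms(1) eigenbasis_diagonal[OF assms(2,3)] by (metis psd_def)

lemma state_eigenvalues:
  assumes "\<sigma> \<in> states" "eigenbasis \<sigma> B p"
  shows state_eigenvalue_nonneg: "b \<in> B \<Longrightarrow> 0 \<le> p b"
    and state_eigenvalue_sum: "(\<Sum>b\<in>B. p b) = 2"
  using assms psd_eigenvalue_nonneg Re_trace_eigenbasis[OF assms(2)] by (auto simp: states_def)

lemma state_eigenbasis:
  assumes "\<sigma> \<in> states"
  obtains B p where "eigenbasis \<sigma> B p"
  using assms hermitian_eigenbasis by (auto simp: states_def psd_def)

text \<open>Real eigenvalues come in pairs: if \<open>b\<close> is an eigenvector then so is \<open>\<i> b\<close>, which is orthogonal
  to \<open>b\<close>. Since the real trace is twice the complex one, the eigenvalues of a state are at most 1.\<close>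

lemma state_eigenvalue_le_1:
  assumes \<sigma>: "\<sigma> \<in> states" and eb: "eigenbasis \<sigma> B p" and b: "b \<in> B"
  shows "p b \<le> 1"
proof -
  note B = eigenbasis_onb[OF eb]
  define w where "w = \<i> *s b"
  have ww: "w \<bullet> w = 1" and wb: "w \<bullet> b = 0"
    using onb_inner[OF B b b] by (simp_all add: w_def inner_imaginary_unit inner_commute[of "\<i> *s b" b])
  have sq: "(w \<bullet> c)\<^sup>2 \<le> 1" if "c \<in> B" for c
    using Cauchy_Schwarz_ineq[of w c] onb_inner[OF B that that] ww by simp
  have "\<sigma> *v w = p b *\<^sub>R w"
    by (simp add: w_def imaginary_unit_commute eigenbasis_mult[OF eb b] imaginary_unit_scaleR)
  then have "p b = w \<bullet> (\<sigma> *v w)"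
    by (simp add: ww)
  also have "\<dots> = (\<Sum>c\<in>B. p c * (w \<bullet> c)\<^sup>2)"
    by (rule eigenbasis_quadratic_form[OF eb])
  \<comment> \<open>The term of \<open>b\<close> drops out by orthogonality and the other weights
    are at most 1, so \<open>p b\<close> is bounded by the remaining eigenvalue mass
    \<open>2 - p b\<close>.\<close>
  also have "\<dots> = (\<Sum>c\<in>B - {b}. p c * (w \<bullet> c)\<^sup>2)"
    by (simp add: sum.remove[OF onb_finite[OF B] b] wb)
  also have "\<dots> \<le> (\<Sum>c\<in>B - {b}. p c)"
    using sq state_eigenvalue_nonneg[OF \<sigma> eb] by (intro sum_mono) (simp add: mult_left_le)
  also have "\<dots> = 2 - p b"
    using state_eigenvalue_sum[OF \<sigma> eb] sum.remove[OF onb_finite[OF B] b, of p] by linarith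
  finally show ?thesis by simp
qed

lemma entropy_nonneg:
  assumes "\<sigma> \<in> states"
  shows "0 \<le> entropy \<sigma>"
proof -
  obtain B p where eb: "eigenbasis \<sigma> B p"
    using assms by (rule state_eigenbasis)
  have "p b * ln (p b) \<le> 0" if b: "b \<in> B" for b
    using state_eigenvalue_nonneg[OF assms eb b] state_eigenvalue_le_1[OF assms eb b]
    by (cases "p b = 0") (auto intro: mult_nonneg_nonpos)
  then show ?thesis
    by (simp add: entropy_eigenbasis[OF eb] sum_nonpos)
qed

text \<open>Expresses the trace through two unrelated eigenbases at once; the weights
  \<open>(b \<bullet> d)\<^sup>2\<close> reappear in the relative entropy.\<close>

lemma expval_eigenbases:
  assumes "eigenbasis \<sigma> B p" "eigenbasis H D h"
  shows "expval H \<sigma> = (\<Sum>b\<in>B. \<Sum>d\<in>D. (b \<bullet> d)\<^sup>2 * (p b * h d)) / 2"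
  unfolding expval_eigenbasis[OF assms(1)] eigenbasis_quadratic_form[OF assms(2)]
  by (simp add: sum_distrib_left mult_ac)

text \<open>By Parseval for unit vectors the squared overlaps form a doubly stochastic matrix, so
  summing out the index on which the summand does not depend costs nothing.\<close>

lemma onb_sum_inner_squares:
  assumes "orthonormal_basis B" "orthonormal_basis D"
  shows "(\<Sum>b\<in>B. \<Sum>d\<in>D. (b \<bullet> d)\<^sup>2 * p b) = (\<Sum>b\<in>B. p b)"
    and "(\<Sum>b\<in>B. \<Sum>d\<in>D. (b \<bullet> d)\<^sup>2 * q d) = (\<Sum>d\<in>D. q d)"
proof -
  have one: "(\<Sum>d\<in>D. (b \<bullet> d)\<^sup>2) = 1" if "orthonormal_basis B" "orthonormal_basis D" "b \<in> B"
    for b and B D :: "'a set"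
    using onb_inner_expand[OF that(2), of b b] onb_inner[OF that(1,3,3)] by (simp add: power2_eq_square)
  show "(\<Sum>b\<in>B. \<Sum>d\<in>D. (b \<bullet> d)\<^sup>2 * p b) = (\<Sum>b\<in>B. p b)"
    using one[OF assms] by (simp add: sum_distrib_right[symmetric])
  show "(\<Sum>b\<in>B. \<Sum>d\<in>D. (b \<bullet> d)\<^sup>2 * q d) = (\<Sum>d\<in>D. q d)"
    by (subst sum.swap) (simp add: sum_distrib_right[symmetric] inner_commute[of _ "_ :: 'a"] one[OF assms(2,1)])
qed

text \<open>The expectation value is an average of the eigenvalues \<open>h d\<close> with
  nonnegative weights \<open>(b \<bullet> d)\<^sup>2 * p b / 2\<close> of total 1.\<close>

lemma expval_ge_eigenvalue_bound:
  assumes \<sigma>: "\<sigma> \<in> states" and H: "eigenbasis H D h" and m: "\<And>d. d \<in> D \<Longrightarrow> m \<le> h d"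
  shows "m \<le> expval H \<sigma>"
proof -
  obtain B p where eb: "eigenbasis \<sigma> B p"
    using \<sigma> by (rule state_eigenbasis)
  have "m * 2 = (\<Sum>b\<in>B. \<Sum>d\<in>D. (b \<bullet> d)\<^sup>2 * (p b * m))"
    using onb_sum_inner_squares(1)[OF eigenbasis_onb[OF eb] eigenbasis_onb[OF H], of "\<lambda>b. p b * m"]
      state_eigenvalue_sum[OF \<sigma> eb] unfolding sum_distrib_right[symmetric] by simp
  also have "\<dots> \<le> (\<Sum>b\<in>B. \<Sum>d\<in>D. (b \<bullet> d)\<^sup>2 * (p b * h d))"
    using m state_eigenvalue_nonneg[OF \<sigma> eb] by (intro sum_mono mult_left_mono) auto
  finally show ?thesis
    by (simp add: expval_eigenbases[OF eb H])
qed

section \<open>Thermal states and their free energy\<close>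

definition partition_function :: "real \<Rightarrow> complex^'n^'n \<Rightarrow> real" where
  "partition_function \<beta> H = Re (trace (matrix_fun exp (- \<beta> *\<^sub>R H)))"

lemma partition_function_eigenbasis:
  assumes "eigenbasis H D h"
  shows "partition_function \<beta> H = (\<Sum>d\<in>D. exp (- \<beta> * h d)) / 2"
    and "partition_function \<beta> H > 0"
proof -
  show *: "partition_function \<beta> H = (\<Sum>d\<in>D. exp (- \<beta> * h d)) / 2"
    unfolding partition_function_def
    by (rule Re_trace_eigenbasis[OF eigenbasis_matrix_fun[OF eigenbasis_scaleR[OF assms]]])
  show "partition_function \<beta> H > 0"
    using onb_finite[OF eigenbasis_onb[OF assms]] onb_nonempty[OF eigenbasis_onb[OF assms]]
    unfolding * by (intro divide_pos_pos sum_pos) auto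
qed

lemma eigenbasis_thermal_state:
  assumes "eigenbasis H D h"
  shows "eigenbasis (thermal_state \<beta> H) D (\<lambda>d. exp (- \<beta> * h d) / partition_function \<beta> H)"
  using eigenbasis_scaleR[OF eigenbasis_matrix_fun[OF eigenbasis_scaleR[OF assms, of "- \<beta>"], of exp],
      of "1 / partition_function \<beta> H"]
  by (simp add: thermal_state_def Let_def partition_function_def)

text \<open>The total is 2 rather than 1 because the real basis lists every complex eigenvalue
  twice.\<close>

lemma thermal_weights_sum:
  assumes "eigenbasis H D h"
  shows "(\<Sum>d\<in>D. exp (- \<beta> * h d) / partition_function \<beta> H) = 2"
proof -
  have "(\<Sum>d\<in>D. exp (- \<beta> * h d) / partition_function \<beta> H)
      = (\<Sum>d\<in>D. exp (- \<beta> * h d)) / partition_function \<beta> H"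
    by (rule sum_divide_distrib[symmetric])
  also have "\<dots> = 2"
    using partition_function_eigenbasis[OF assms, of \<beta>] by (simp add: field_simps)
  finally show ?thesis .
qed

lemma ln_thermal_weight:
  assumes "eigenbasis H D h"
  shows "ln (exp (- \<beta> * h d) / partition_function \<beta> H) = - \<beta> * h d - ln (partition_function \<beta> H)"
  using partition_function_eigenbasis(2)[OF assms, of \<beta>] by (simp add: ln_div)

lemma expval_thermal_state_nonneg:
  assumes "psd H"
  shows "0 \<le> expval H (thermal_state \<beta> H)"
proof -
  obtain D h where H: "eigenbasis H D h"
    using assms hermitian_eigenbasis psd_def by blast
  show ?thesis
    unfolding expval_eigenbasis[OF eigenbasis_thermal_state[OF H]]
    using psd_eigenvalue_nonneg[OF assms H] partition_function_eigenbasis(2)[OF H, of \<beta>]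
    by (intro divide_nonneg_nonneg sum_nonneg mult_nonneg_nonneg) (auto simp: eigenbasis_diagonal[OF H])
qed

text \<open>The logarithm of a Boltzmann weight is affine in the energy, so the entropy of the
  thermal state is \<open>\<beta>\<close> times its mean energy plus
  \<open>ln (partition_function \<beta> H)\<close>, and the energy cancels in the free
  energy.\<close>

lemma free_energy_thermal_state:
  assumes "hermitian H" "\<beta> \<noteq> 0"
  shows "free_energy \<beta> H (thermal_state \<beta> H) = - ln (partition_function \<beta> H) / \<beta>"
proof -
  obtain D h where H: "eigenbasis H D h"
    using assms(1) by (rule hermitian_eigenbasis)
  define q where "q = (\<lambda>d. exp (- \<beta> * h d) / partition_function \<beta> H)"
  have q: "eigenbasis (thermal_state \<beta> H) D q" and sum: "(\<Sum>d\<in>D. q d) = 2"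
    and ln: "ln (q d) = - \<beta> * h d - ln (partition_function \<beta> H)" for d
    unfolding q_def using eigenbasis_thermal_state[OF H] thermal_weights_sum[OF H] ln_thermal_weight[OF H]
    by auto
  have "(\<Sum>d\<in>D. q d * ln (q d)) = - \<beta> * (\<Sum>d\<in>D. q d * h d) - (\<Sum>d\<in>D. q d) * ln (partition_function \<beta> H)"
    by (simp add: ln algebra_simps sum.distrib sum_subtractf sum_negf sum_distrib_left sum_distrib_right)
  then have "entropy (thermal_state \<beta> H) = \<beta> * expval H (thermal_state \<beta> H) + ln (partition_function \<beta> H)"
    by (simp add: sum entropy_eigenbasis[OF q] expval_eigenbasis[OF q] eigenbasis_diagonal[OF H])
  then show ?thesis
    using assms(2) by (simp add: free_energy_def field_simps)
qed

section \<open>Gibbs' variational principle via Klein's inequality\<close>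

text \<open>For \<open>p > 0\<close> the expression is \<open>p\<close> times
  \<open>(x - 1) - ln x\<close> at \<open>x = q / p\<close>, and \<open>ln x \<le> x - 1\<close> is
  an equality only at \<open>x = 1\<close>. For \<open>p = 0\<close> it reduces to
  \<open>q > 0\<close>.\<close>

lemma Klein_inequality_term:
  fixes p q :: real
  assumes "0 \<le> p" "0 < q"
  shows "0 \<le> p * (ln p - ln q) - p + q"
    and "p * (ln p - ln q) - p + q = 0 \<Longrightarrow> p = q"
proof -
  have "0 \<le> p * (ln p - ln q) - p + q \<and> (p * (ln p - ln q) - p + q = 0 \<longrightarrow> p = q)"
  proof (cases "p = 0")
    case False
    then have p: "p > 0" using assms by simp
    have e: "p * (ln p - ln q) - p + q = p * ((q / p - 1) - ln (q / p))"
      using p assms by (simp add: ln_div field_simps)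
    have "0 \<le> (q / p - 1) - ln (q / p)"
      using ln_le_minus_one[of "q / p"] p assms by simp
    moreover have "p = q" if "ln (q / p) = q / p - 1"
      using ln_eq_minus_one[OF _ that] p assms by simp
    ultimately show ?thesis
      unfolding e using p by (auto simp: mult_nonneg_nonneg)
  qed (use assms in auto)
  then show "0 \<le> p * (ln p - ln q) - p + q" "p * (ln p - ln q) - p + q = 0 \<Longrightarrow> p = q"
    by auto
qed

text \<open>\<open>\<beta>\<close> times the extractable work is the
  relative entropy of \<open>\<sigma>\<close> and the thermal state, which in eigenbases is a combination of the terms
  of Klein's inequality with weights \<open>(b \<bullet> d)\<^sup>2\<close>.\<close>

lemma
  assumes \<sigma>: "\<sigma> \<in> states" and herm: "hermitian H" and \<beta>: "\<beta> > 0"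
  shows work_out_nonneg: "0 \<le> work_out \<beta> H \<sigma>"
    and work_out_eq_0: "work_out \<beta> H \<sigma> = 0 \<Longrightarrow> \<sigma> = thermal_state \<beta> H"
proof -
  obtain B p where eb: "eigenbasis \<sigma> B p"
    using \<sigma> by (rule state_eigenbasis)
  obtain D h where H: "eigenbasis H D h"
    using herm by (rule hermitian_eigenbasis)
  note B = eigenbasis_onb[OF eb] and D = eigenbasis_onb[OF H]
  define Z where "Z = partition_function \<beta> H"
  define q where "q = (\<lambda>d. exp (- \<beta> * h d) / Z)"
  have q: "eigenbasis (thermal_state \<beta> H) D q" and qsum: "(\<Sum>d\<in>D. q d) = 2"
    and ln: "ln (q d) = - \<beta> * h d - ln Z" and qpos: "q d > 0" for d
    unfolding q_def Z_def using eigenbasis_thermal_state[OF H] thermal_weights_sum[OF H]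
      ln_thermal_weight[OF H] partition_function_eigenbasis(2)[OF H] by auto
  define k where "k = (\<lambda>b d. p b * (ln (p b) - ln (q d)) - p b + q d)"
  have k: "0 \<le> (b \<bullet> d)\<^sup>2 * k b d" if "b \<in> B" for b d
    unfolding k_def using Klein_inequality_term(1)[OF state_eigenvalue_nonneg[OF \<sigma> eb that] qpos] by simp
  have "(\<Sum>b\<in>B. \<Sum>d\<in>D. (b \<bullet> d)\<^sup>2 * k b d) =
      (\<Sum>b\<in>B. \<Sum>d\<in>D. (b \<bullet> d)\<^sup>2 * (p b * ln (p b))) + \<beta> * (\<Sum>b\<in>B. \<Sum>d\<in>D. (b \<bullet> d)\<^sup>2 * (p b * h d))
      + ln Z * (\<Sum>b\<in>B. \<Sum>d\<in>D. (b \<bullet> d)\<^sup>2 * p b) - (\<Sum>b\<in>B. \<Sum>d\<in>D. (b \<bullet> d)\<^sup>2 * p b)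
      + (\<Sum>b\<in>B. \<Sum>d\<in>D. (b \<bullet> d)\<^sup>2 * q d)"
    unfolding sum_distrib_left sum.distrib[symmetric] sum_subtractf[symmetric]
    by (simp add: k_def ln algebra_simps)
  \<comment> \<open>Double stochasticity collapses the sums over a single index; the contributions
    of \<open>- p b\<close> and \<open>q d\<close> cancel, since both total 2.\<close>
  also have "\<dots> = (\<Sum>b\<in>B. p b * ln (p b)) + \<beta> * (\<Sum>b\<in>B. \<Sum>d\<in>D. (b \<bullet> d)\<^sup>2 * (p b * h d)) + 2 * ln Z"
    unfolding onb_sum_inner_squares[OF B D] qsum state_eigenvalue_sum[OF \<sigma> eb] by simp
  also have "\<dots> = 2 * \<beta> * work_out \<beta> H \<sigma>"
    using \<beta> unfolding work_out_def free_energy_thermal_state[OF herm less_imp_neq[OF \<beta>, symmetric]]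
    by (simp add: free_energy_def expval_eigenbases[OF eb H] entropy_eigenbasis[OF eb] Z_def field_simps)
  finally have sum: "(\<Sum>b\<in>B. \<Sum>d\<in>D. (b \<bullet> d)\<^sup>2 * k b d) = 2 * \<beta> * work_out \<beta> H \<sigma>" .
  have "0 \<le> (\<Sum>b\<in>B. \<Sum>d\<in>D. (b \<bullet> d)\<^sup>2 * k b d)"
    using k by (intro sum_nonneg)
  then show "0 \<le> work_out \<beta> H \<sigma>"
    using \<beta> unfolding sum by (simp add: zero_le_mult_iff)
  assume "work_out \<beta> H \<sigma> = 0"
  then have "(\<Sum>b\<in>B. \<Sum>d\<in>D. (b \<bullet> d)\<^sup>2 * k b d) = 0"
    using sum by simp
  then have k0: "(b \<bullet> d)\<^sup>2 * k b d = 0" if "b \<in> B" "d \<in> D" for b d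
    using that k onb_finite[OF B] onb_finite[OF D] by (simp add: sum_nonneg_eq_0_iff sum_nonneg)
  have same: "thermal_state \<beta> H *v b = \<sigma> *v b" if b: "b \<in> B" for b
  proof -
    \<comment> \<open>Either the overlap is zero and both sides vanish, or \<open>k b d = 0\<close>
      and the equality case of Klein's inequality gives \<open>p b = q d\<close>.\<close>
    have pq: "(b \<bullet> d) * q d = (b \<bullet> d) * p b" if d: "d \<in> D" for d
      using k0[OF b d] Klein_inequality_term(2)[OF state_eigenvalue_nonneg[OF \<sigma> eb b] qpos[of d]]
      by (auto simp: k_def)
    have "thermal_state \<beta> H *v b = (\<Sum>d\<in>D. ((b \<bullet> d) * q d) *\<^sub>R d)"
      by (subst onb_linear_expand[OF D]) (simp_all add: eigenbasis_mult[OF q])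
    also have "\<dots> = (\<Sum>d\<in>D. p b *\<^sub>R ((b \<bullet> d) *\<^sub>R d))"
      by (intro sum.cong) (simp_all add: pq)
    also have "\<dots> = \<sigma> *v b"
      by (simp add: scaleR_sum_right[symmetric] onb_expand[OF D] eigenbasis_mult[OF eb b] del: scaleR_scaleR)
    finally show ?thesis .
  qed
  have "\<sigma> *v v = thermal_state \<beta> H *v v" for v
    unfolding onb_linear_expand[OF B matrix_vector_mul_linear[of \<sigma>], of v]
      onb_linear_expand[OF B matrix_vector_mul_linear[of "thermal_state \<beta> H"], of v]
    by (intro sum.cong) (simp_all add: same)
  then show "\<sigma> = thermal_state \<beta> H"
    by (simp add: matrix_eq)
qed

section \<open>Boundedness of the states and positivity of the robustness\<close>

text \<open>Eigenvalues in [0, 1] can only shrink the coordinates in an eigenbasis. Applied to unit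
  vectors, this bounds every matrix entry of a state.\<close>

lemma state_norm_mult_le:
  assumes "\<sigma> \<in> states"
  shows "norm (\<sigma> *v v) \<le> norm v"
proof -
  obtain B p where eb: "eigenbasis \<sigma> B p"
    using assms by (rule state_eigenbasis)
  note B = eigenbasis_onb[OF eb]
  have herm: "hermitian \<sigma>" using assms by (simp add: states_def psd_def)
  have "(\<sigma> *v v) \<bullet> (\<sigma> *v v) = (\<Sum>b\<in>B. (p b * (v \<bullet> b)) * (p b * (v \<bullet> b)))"
    by (subst onb_inner_expand[OF B]) (simp add: hermitian_inner[OF herm] eigenbasis_mult[OF eb])
  also have "\<dots> \<le> (\<Sum>b\<in>B. (v \<bullet> b) * (v \<bullet> b))"
  proof (rule sum_mono)
    fix b assume b: "b \<in> B"
    have "p b * p b \<le> 1"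
      using state_eigenvalue_nonneg[OF assms eb b] state_eigenvalue_le_1[OF assms eb b] by (simp add: mult_le_one)
    then have "(p b * p b) * ((v \<bullet> b) * (v \<bullet> b)) \<le> 1 * ((v \<bullet> b) * (v \<bullet> b))"
      by (rule mult_right_mono) simp
    then show "(p b * (v \<bullet> b)) * (p b * (v \<bullet> b)) \<le> (v \<bullet> b) * (v \<bullet> b)"
      by (simp add: mult_ac)
  qed
  also have "\<dots> = v \<bullet> v"
    by (rule onb_inner_expand[OF B, symmetric])
  finally show ?thesis
    by (simp add: norm_le)
qed

lemma bounded_states: "bounded (states :: (complex^'n^'n) set)"
proof (rule boundedI)
  fix \<sigma> :: "complex^'n^'n" assume \<sigma>: "\<sigma> \<in> states"
  have entry: "norm (\<sigma> $ i $ j) \<le> 1" for i j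
  proof -
    have "\<sigma> $ i $ j = (\<sigma> *v axis j 1) $ i"
      by (simp add: matrix_vector_mult_def axis_def if_distrib cong: if_cong)
    also have "norm \<dots> \<le> norm (\<sigma> *v axis j 1)"
      by (rule Finite_Cartesian_Product.norm_nth_le)
    also have "\<dots> \<le> norm (axis j (1 :: complex))"
      by (rule state_norm_mult_le[OF \<sigma>])
    also have "\<dots> = 1"
      by (simp add: norm_eq_1 inner_axis_axis)
    finally show ?thesis .
  qed
  have "norm \<sigma> \<le> (\<Sum>i\<in>UNIV. norm (\<sigma> $ i))"
    unfolding norm_vec_def[of \<sigma>] by (rule L2_set_le_sum) simp
  also have "\<dots> \<le> (\<Sum>i\<in>UNIV. \<Sum>j\<in>UNIV. norm (\<sigma> $ i $ j))"
    unfolding norm_vec_def[of "\<sigma> $ _"] by (intro sum_mono L2_set_le_sum) simp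
  also have "\<dots> \<le> (\<Sum>i\<in>(UNIV :: 'n set). \<Sum>j\<in>(UNIV :: 'n set). 1)"
    by (intro sum_mono entry)
  finally show "norm \<sigma> \<le> (\<Sum>i\<in>(UNIV :: 'n set). \<Sum>j\<in>(UNIV :: 'n set). 1)" .
qed

text \<open>If the infimum were 0, free mixtures of \<open>\<rho>\<close> with arbitrarily small
  admixtures \<open>s\<close> would exist. They converge to \<open>\<rho>\<close> because states are
  bounded, and closedness of \<open>L\<close> would make \<open>\<rho>\<close> free.\<close>

lemma robustness_pos:
  assumes "closed L" "\<rho> \<in> states" "\<rho> \<notin> L"
  shows "0 < robustness L \<rho>"
proof (rule ccontr)
  assume "\<not> 0 < robustness L \<rho>"
  then have R: "robustness L \<rho> \<le> 0" by simp
  obtain C where C: "C > 0" "\<And>\<sigma> :: complex^'a^'a. \<sigma> \<in> states \<Longrightarrow> norm \<sigma> \<le> C"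
    using bounded_states bounded_pos by metis
  have "\<exists>x\<in>L. dist x \<rho> < e" if e: "e > 0" for e
  proof -
    \<comment> \<open>Two states are at distance at most \<open>2 * C\<close>, so an admixture
      \<open>s\<close> below \<open>e / (2 * C)\<close> moves \<open>\<rho>\<close> by less than
      \<open>e\<close>.\<close>
    have "robustness L \<rho> < ereal (e / (2 * C))"
      using R e C(1) by (metis ereal_less(2) order_le_less_trans divide_pos_pos mult_pos_pos zero_less_numeral)
    then obtain s \<gamma> where s: "0 \<le> s" "s < e / (2 * C)" and \<gamma>: "\<gamma> \<in> states"
      and x: "(1 / (1 + s)) *\<^sub>R (\<rho> + s *\<^sub>R \<gamma>) \<in> L"
      by (auto simp: robustness_def INF_less_iff)
    have "(1 + s) *\<^sub>R ((1 / (1 + s)) *\<^sub>R (\<rho> + s *\<^sub>R \<gamma>) - \<rho>) = s *\<^sub>R (\<gamma> - \<rho>)"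
      using s(1) by (simp add: scaleR_diff_right scaleR_add_left)
    then have "norm ((1 + s) *\<^sub>R ((1 / (1 + s)) *\<^sub>R (\<rho> + s *\<^sub>R \<gamma>) - \<rho>)) = norm (s *\<^sub>R (\<gamma> - \<rho>))"
      by simp
    then have "(1 + s) * dist ((1 / (1 + s)) *\<^sub>R (\<rho> + s *\<^sub>R \<gamma>)) \<rho> = s * norm (\<gamma> - \<rho>)"
      using s(1) unfolding norm_scaleR dist_norm by simp
    moreover have "dist ((1 / (1 + s)) *\<^sub>R (\<rho> + s *\<^sub>R \<gamma>)) \<rho> \<le> (1 + s) * dist ((1 / (1 + s)) *\<^sub>R (\<rho> + s *\<^sub>R \<gamma>)) \<rho>"
      using mult_right_mono[of 1 "1 + s" "dist ((1 / (1 + s)) *\<^sub>R (\<rho> + s *\<^sub>R \<gamma>)) \<rho>"] s(1) by simp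
    moreover have "s * norm (\<gamma> - \<rho>) \<le> s * (2 * C)"
      using norm_triangle_ineq4[of \<gamma> \<rho>] C(2)[OF \<gamma>] C(2)[OF assms(2)] s(1) by (intro mult_left_mono) linarith+
    moreover have "s * (2 * C) < e"
      using s(2) C(1) by (simp add: field_simps)
    ultimately have "dist ((1 / (1 + s)) *\<^sub>R (\<rho> + s *\<^sub>R \<gamma>)) \<rho> < e"
      by linarith
    with x show ?thesis by blast
  qed
  then have "\<rho> \<in> L"
    using closed_approachable[OF assms(1)] by blast
  with assms(3) show False ..
qed

section \<open>The work-extraction advantage\<close>

text \<open>Common to both temperatures, hence abstract in \<open>W\<close>. The best free work is a
  real number in \<open>[0, E]\<close>: if it is positive, replacing it by \<open>E\<close> only
  lowers the ratio; if it is 0, \<open>strict\<close> makes the ratio infinite.\<close>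

lemma work_advantage_ge:
  assumes H: "psd H" and L: "\<sigma> \<in> L" "\<And>\<sigma>. \<sigma> \<in> L \<Longrightarrow> 0 \<le> W H \<sigma>" "\<And>\<sigma>. \<sigma> \<in> L \<Longrightarrow> W H \<sigma> \<le> E"
    and \<rho>: "E \<le> W H \<rho>" "0 \<le> W H \<rho>"
    and strict: "(\<And>\<sigma>. \<sigma> \<in> L \<Longrightarrow> W H \<sigma> = 0) \<Longrightarrow> 0 < W H \<rho>"
    and c: "0 < E \<Longrightarrow> c \<le> W H \<rho> / E"
  shows "ereal c \<le> work_advantage W L \<rho>"
proof -
  define S where "S = (SUP \<sigma>\<in>L. ereal (W H \<sigma>))"
  have le_S: "ereal (W H \<tau>) \<le> S" if "\<tau> \<in> L" for \<tau>
    unfolding S_def using that by (rule SUP_upper)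
  have S_le: "S \<le> ereal E"
    unfolding S_def using L(3) by (intro SUP_least) simp
  have S_nonneg: "0 \<le> S"
    using le_S[OF L(1)] L(2)[OF L(1)] by (meson ereal_less_eq(5) order_trans)
  obtain r where r: "S = ereal r" "0 \<le> r" "r \<le> E"
    using S_le S_nonneg by (cases S) auto
  \<comment> \<open>Besides the bound, positivity is recorded: it shows that \<open>H\<close> is not
    among the Hamiltonians excluded from the supremum.\<close>
  have "W H \<rho> > 0 \<and> ereal c \<le> ereal (W H \<rho>) / S"
  proof (cases "r = 0")
    case True
    then have "W H \<tau> = 0" if "\<tau> \<in> L" for \<tau>
      using le_S[OF that] L(2)[OF that] r(1) by simp
    then have "0 < W H \<rho>" by (rule strict)
    then show ?thesis using True r(1) by (simp add: divide_ereal_def zero_ereal_def[symmetric])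
  next
    case False
    with r(2,3) have "0 < r" "0 < E" by simp_all
    have "c \<le> W H \<rho> / E" using \<open>0 < E\<close> by (rule c)
    also have "\<dots> \<le> W H \<rho> / r"
      using \<open>0 < r\<close> r(3) \<rho> by (intro divide_left_mono) auto
    finally show ?thesis
      using \<open>0 < r\<close> \<open>0 < E\<close> \<rho>(1) r(1) by simp
  qed
  then show ?thesis
    unfolding work_advantage_def S_def
    by (intro order_trans[OF _ SUP_upper]) (use H in auto)
qed

lemma xi_out_ge:
  assumes L: "\<sigma> \<in> L" "L \<subseteq> states" and \<rho>: "\<rho> \<in> states" "\<rho> \<notin> L"
    and Y: "psd Y" "\<forall>\<sigma>\<in>L. expval Y \<sigma> \<le> 1"
    and R: "expval Y \<rho> = 1 + R"
    and \<beta>: "\<beta> > 0" and t: "t > 0" "entropy \<rho> / \<beta> \<le> t * R"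
  shows "ereal (1 + (R - entropy \<rho> / (t * \<beta>)) /
      (1 + entropy (thermal_state \<beta> (t *\<^sub>R Y)) / (t * \<beta>))) \<le> xi_out \<beta> L \<rho>"
proof -
  define H where "H = t *\<^sub>R Y"
  define \<tau> where "\<tau> = thermal_state \<beta> H"
  define x where "x = - free_energy \<beta> H \<tau>"
  have H: "psd H"
    unfolding H_def using Y(1) t(1) by (intro psd_scaleR) simp_all
  then have herm: "hermitian H" by (simp add: psd_def)
  have W: "work_out \<beta> H \<omega> = t * expval Y \<omega> - entropy \<omega> / \<beta> + x" for \<omega>
    by (simp add: work_out_def free_energy_def x_def \<tau>_def H_def expval_scaleR)
  have x: "x \<le> entropy \<tau> / \<beta>"
    using expval_thermal_state_nonneg[OF H] by (simp add: x_def free_energy_def \<tau>_def)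
  show ?thesis
    unfolding xi_out_def H_def[symmetric] \<tau>_def[symmetric]
  proof (rule work_advantage_ge[OF H L(1), where E = "t + x"])
    show "0 \<le> work_out \<beta> H \<omega>" if "\<omega> \<in> L" for \<omega>
      using that L(2) work_out_nonneg[OF _ herm \<beta>] by blast
    show "work_out \<beta> H \<omega> \<le> t + x" if \<omega>: "\<omega> \<in> L" for \<omega>
    proof -
      have "0 \<le> entropy \<omega> / \<beta>"
        using \<omega> L(2) \<beta> entropy_nonneg by (intro divide_nonneg_pos) auto
      moreover have "t * expval Y \<omega> \<le> t"
        using bspec[OF Y(2) \<omega>] t(1) by simp
      ultimately show ?thesis unfolding W by linarith
    qed
    \<comment> \<open>The lower bound on \<open>t\<close> says exactly this: the gain
      \<open>t * R\<close> compensates the entropy cost of \<open>\<rho>\<close>.\<close>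
    show "t + x \<le> work_out \<beta> H \<rho>"
      using t(2) by (simp add: W R distrib_left)
    show "0 \<le> work_out \<beta> H \<rho>"
      by (rule work_out_nonneg[OF \<rho>(1) herm \<beta>])
    show "0 < work_out \<beta> H \<rho>" if "\<And>\<omega>. \<omega> \<in> L \<Longrightarrow> work_out \<beta> H \<omega> = 0"
    proof (rule ccontr)
      assume "\<not> 0 < work_out \<beta> H \<rho>"
      then have "\<rho> = \<tau>"
        unfolding \<tau>_def using work_out_nonneg[OF \<rho>(1) herm \<beta>] by (intro work_out_eq_0[OF \<rho>(1) herm \<beta>]) simp
      moreover have "\<sigma> = \<tau>"
        unfolding \<tau>_def using L that by (intro work_out_eq_0[OF _ herm \<beta>]) auto
      ultimately show False using L(1) \<rho>(2) by simp
    qed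
    assume E: "0 < t + x"
    define a b where "a = entropy \<rho> / \<beta>" and "b = entropy \<tau> / \<beta>"
    have ab: "entropy \<rho> / (t * \<beta>) = a / t" "entropy \<tau> / (t * \<beta>) = b / t"
      by (simp_all add: a_def b_def mult.commute)
    have "R - a / t = (t * R - a) / t" "1 + b / t = (t + b) / t"
      using t(1) by (simp_all add: diff_divide_distrib add_divide_distrib)
    then have "(R - a / t) / (1 + b / t) = (t * R - a) / (t + b)"
      using t(1) by simp
    \<comment> \<open>The numerator is nonnegative by the choice of \<open>t\<close>, and
      \<open>x \<le> b\<close>, so the denominator may shrink to \<open>t + x\<close>.\<close>
    also have "\<dots> \<le> (t * R - a) / (t + x)"
      using E x t(2) by (intro divide_left_mono) (auto simp: a_def b_def)
    also have "\<dots> = (work_out \<beta> H \<rho> - (t + x)) / (t + x)"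
      by (simp add: W R a_def distrib_left)
    also have "\<dots> = work_out \<beta> H \<rho> / (t + x) - 1"
      using E by (simp add: diff_divide_distrib)
    finally show "1 + (R - entropy \<rho> / (t * \<beta>)) / (1 + entropy \<tau> / (t * \<beta>)) \<le> work_out \<beta> H \<rho> / (t + x)"
      unfolding ab by simp
  qed
qed

lemma xi_out_zero_temp_ge:
  assumes L: "\<sigma> \<in> L" "L \<subseteq> states" and Y: "psd Y" "\<forall>\<sigma>\<in>L. expval Y \<sigma> \<le> 1"
    and R: "expval Y \<rho> = 1 + R" "R > 0"
  shows "ereal (1 + R) \<le> xi_out_zero_temp L \<rho>"
proof -
  obtain B e where eb: "eigenbasis Y B e"
    using Y(1) hermitian_eigenbasis psd_def by blast
  define m where "m = Min (real_eigenvalues Y)"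
  have fin: "finite (e ` B)" "e ` B \<noteq> {}"
    using onb_finite[OF eigenbasis_onb[OF eb]] onb_nonempty[OF eigenbasis_onb[OF eb]] by auto
  have m: "m \<le> e b" if "b \<in> B" for b
    unfolding m_def real_eigenvalues_eigenbasis[OF eb] using fin that by simp
  have m0: "0 \<le> m"
    unfolding m_def real_eigenvalues_eigenbasis[OF eb]
    using fin psd_eigenvalue_nonneg[OF Y(1) eb] by auto
  have mL: "m \<le> expval Y \<omega>" if "\<omega> \<in> L" for \<omega>
    using that L(2) m by (intro expval_ge_eigenvalue_bound[OF _ eb]) auto
  \<comment> \<open>Any free state squeezes \<open>m\<close> below its expectation value of
    \<open>Y\<close>, hence below 1.\<close>
  have m1: "m \<le> 1"
    using mL[OF L(1)] bspec[OF Y(2) L(1)] by linarith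
  have W: "work_out_zero_temp Y \<omega> = expval Y \<omega> - m" for \<omega>
    by (simp add: work_out_zero_temp_def m_def)
  show ?thesis
    unfolding xi_out_zero_temp_def
  proof (rule work_advantage_ge[OF Y(1) L(1), where E = "1 - m"])
    show "1 + R \<le> work_out_zero_temp Y \<rho> / (1 - m)" if "0 < 1 - m"
    proof -
      \<comment> \<open>The two sides differ by \<open>R * m\<close>, which is nonnegative.\<close>
      have "(1 + R) * (1 - m) \<le> 1 + R - m"
        using m0 R(2) by (simp add: algebra_simps)
      then show ?thesis
        using that by (simp add: W R(1) pos_le_divide_eq)
    qed
    show "0 \<le> work_out_zero_temp Y \<omega>" "work_out_zero_temp Y \<omega> \<le> 1 - m" if "\<omega> \<in> L" for \<omega>
      using mL[OF that] bspec[OF Y(2) that] unfolding W by linarith+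
    \<comment> \<open>Strict positivity is unconditional here, as the work of \<open>\<rho>\<close>
      is \<open>1 + R - m \<ge> R > 0\<close>. In particular, \<open>m = 1\<close> gives an infinite
      ratio.\<close>
    show "1 - m \<le> work_out_zero_temp Y \<rho>" "0 \<le> work_out_zero_temp Y \<rho>" "0 < work_out_zero_temp Y \<rho>"
      using R m1 unfolding W by linarith+
  qed
qed

theorem theorem1:
  fixes L :: "(complex^'n^'n) set" and \<rho> Y :: "complex^'n^'n" and \<beta> :: real
  assumes "L \<noteq> {}" and "closed L" and "convex L" and "L \<subseteq> states"
    and "\<rho> \<in> states" and "\<rho> \<notin> L"
    and "optimal_witness L \<rho> Y"
    and "\<beta> > 0"
  shows "(\<forall>t::real. t > 0 \<longrightarrow> t \<ge> entropy \<rho> / \<beta> / real_of_ereal (robustness L \<rho>) \<longrightarrow>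
            xi_out \<beta> L \<rho> \<ge>
              ereal (1 + (real_of_ereal (robustness L \<rho>) - entropy \<rho> / (t * \<beta>)) /
                         (1 + entropy (thermal_state \<beta> (t *\<^sub>R Y)) / (t * \<beta>))))
         \<and> xi_out_zero_temp L \<rho> \<ge> 1 + robustness L \<rho>"
proof -
  obtain \<sigma> where \<sigma>: "\<sigma> \<in> L" using assms(1) by blast
  \<comment> \<open>The witness attains the robustness, which is therefore a finite real number, and
    \<open>real_of_ereal\<close> recovers it faithfully.\<close>
  define R where "R = expval Y \<rho> - 1"
  have Y: "psd Y" "\<forall>\<sigma>\<in>L. expval Y \<sigma> \<le> 1" and R: "robustness L \<rho> = ereal R"
    using assms(7) by (simp_all add: optimal_witness_def R_def)
  have exp: "expval Y \<rho> = 1 + R" by (simp add: R_def)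
  \<comment> \<open>Positivity allows the condition on \<open>t\<close> to be cleared of its
    denominator.\<close>
  have pos: "R > 0"
    using robustness_pos[OF assms(2,5,6)] by (simp add: R)
  have "ereal (1 + (R - entropy \<rho> / (t * \<beta>)) / (1 + entropy (thermal_state \<beta> (t *\<^sub>R Y)) / (t * \<beta>)))
      \<le> xi_out \<beta> L \<rho>" if "t > 0" "t \<ge> entropy \<rho> / \<beta> / R" for t
    using that(1) that(2)[unfolded pos_divide_le_eq[OF pos]]
    by (rule xi_out_ge[OF \<sigma> assms(4,5,6) Y exp assms(8)])
  moreover have "1 + robustness L \<rho> \<le> xi_out_zero_temp L \<rho>"
    using xi_out_zero_temp_ge[OF \<sigma> assms(4) Y exp pos] by (simp add: R one_ereal_def)
  ultimately show ?thesis
    unfolding R by simp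
qed

end
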